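(* Let $\Gamma$ be the star graph of a non-redundant cyclic presentation $P_n(w)$ where $w\in F_n$ is cyclically reduced of length at least $3$ and is not a proper power. Then $\mathrm{girth}(\Gamma)\leq 8$ and, moreover, if $\mathrm{girth}(\Gamma)>6$ then $w$ is a non-positive, non-negative word (that is, neither a positive word nor a negative word) of length $3$.
   Context: Cyclic presentations: $F_n$ is the free group with basis $x_0,\ldots,x_{n-1}$ and $\theta:F_n\to F_n$ is the automorphism $\theta(x_i)=x_{i+1}$ (subscripts mod $n$). For a cyclically reduced word $w\in F_n$, $P_n(w)=\langle x_0,\ldots,x_{n-1}\mid w,\theta(w),\ldots,\theta^{n-1}(w)\rangle$. Throughout it is assumed that $x_0$ is a letter of $w$. A word is positive (negative) if all exponents of its generators are positive (negative). The word $w$ is a proper power if $w=v^t$ for some $v$ and some $t\geq 2$. Non-redundant: a relator $r\in R$ of $\langle X\mid R\rangle$ is freely redundant if it is freely trivial or there is $s\in R$ such that $r,s$ are distinct elements of the free group on $X$ and $r$ is freely conjugate to $s$ or to $s^{-1}$. A presentation is non-redundant if it contains no freely redundant relator. Star graph: let $\tilde R$ be the set of all cyclic permutations of elements of $R\cup R^{-1}$. The star graph of $\langle X\mid R\rangle$ (all relators cyclically reduced) is the undirected graph, possibly with multiple edges, with vertex set $X\cup X^{-1}$ and an edge joining $x$ and $y$ for each distinct word of the form $xy^{-1}u$ in $\tilde R$, where the edges corresponding to the inverse pair $xy^{-1}u$, $yx^{-1}u^{-1}$ are identified. Girth: the length of a shortest reduced closed path of positive length (infinite if none exists), where a path is reduced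 if consecutive edges are never equal; two parallel edges give a reduced closed path of length $2$. *)

theory Defs
  imports "HOL-Algebra.Group" "HOL-Library.Extended_Nat"
begin

section \<open>Words and free groups\<close>

text \<open>The letter \<open>(x, True)\<close> stands for the generator \<open>x\<close> and \<open>(x, False)\<close> for its inverse.\<close>

type_synonym 'a letter = "'a \<times> bool"
type_synonym 'a word = "'a letter list"

definition linv :: "'a letter \<Rightarrow> 'a letter" where
  "linv a = (fst a, \<not> snd a)"

definition winv :: "'a word \<Rightarrow> 'a word" where
  "winv w = rev (map linv w)"

definition reduced :: "'a word \<Rightarrow> bool" where
  "reduced w \<longleftrightarrow> successively (\<lambda>a b. b \<noteq> linv a) w"

definition cyclically_reduced :: "'a word \<Rightarrow> bool" where
  "cyclically_reduced w \<longleftrightarrow> reduced w \<and> (w \<noteq> [] \<longrightarrow> hd w \<noteq> linv (last w))"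

definition positive_word :: "'a word \<Rightarrow> bool" where
  "positive_word w \<longleftrightarrow> (\<forall>a\<in>set w. snd a)"

definition negative_word :: "'a word \<Rightarrow> bool" where
  "negative_word w \<longleftrightarrow> (\<forall>a\<in>set w. \<not> snd a)"

fun lcons :: "'a letter \<Rightarrow> 'a word \<Rightarrow> 'a word" where
  "lcons a [] = [a]"
| "lcons a (b # w) = (if b = linv a then w else a # b # w)"

definition free_reduce :: "'a word \<Rightarrow> 'a word" where
  "free_reduce w = foldr lcons w []"

text \<open>
  Each element of the free group on \<open>X\<close> is represented by its unique reduced word, so that
  equality in the free group is equality of lists.
\<close>

definition free_group :: "'a set \<Rightarrow> 'a word monoid" where
  "free_group X =
     \<lparr> carrier = {w. set w \<subseteq> X \<times> UNIV \<and> reduced w},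
       mult = (\<lambda>u v. free_reduce (u @ v)),
       one = [] \<rparr>"

lemma linv_linv [simp]: "linv (linv a) = a"
  by (simp add: linv_def)

lemma reduced_lcons: "reduced w \<Longrightarrow> reduced (lcons a w)"
  by (cases w) (auto simp: reduced_def successively_Cons)

lemma reduced_free_reduce: "reduced (free_reduce w)"
  by (induction w) (auto simp: free_reduce_def reduced_lcons, simp add: reduced_def)

lemma set_lcons: "set (lcons a w) \<subseteq> insert a (set w)"
  by (cases w) auto

lemma set_free_reduce: "set (free_reduce w) \<subseteq> set w"
  using set_lcons by (induction w) (fastforce simp: free_reduce_def)+

lemma free_reduce_reduced: "reduced w \<Longrightarrow> free_reduce w = w"
proof (induction w)
  case (Cons a w)
  then show ?case by (cases w) (auto simp: free_reduce_def reduced_def)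
qed (simp add: free_reduce_def)

lemma lcons_linv: "reduced w \<Longrightarrow> lcons (linv a) (lcons a w) = w"
  by (cases w rule: remdups_adj.cases) (auto simp: reduced_def)

lemma foldr_lcons_lcons:
  assumes "reduced v"
  shows "foldr lcons (lcons a u) v = lcons a (foldr lcons u v)"
proof -
  have red: "reduced (foldr lcons u v)" for u :: "'a word"
    by (induction u) (auto simp: assms reduced_lcons)
  show ?thesis
    using lcons_linv[of _ "linv a"] red by (cases u) auto
qed

lemma foldr_lcons_free_reduce:
  "reduced v \<Longrightarrow> foldr lcons (free_reduce u) v = foldr lcons u v"
  by (induction u) (auto simp: free_reduce_def foldr_lcons_lcons)

lemma free_reduce_append:
  "free_reduce (free_reduce u @ v) = free_reduce (u @ v)"
  "free_reduce (u @ free_reduce v) = free_reduce (u @ v)"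
proof -
  have split: "free_reduce (u @ v) = foldr lcons u (free_reduce v)" for u v :: "'a word"
    by (simp add: free_reduce_def)
  show "free_reduce (free_reduce u @ v) = free_reduce (u @ v)"
    by (simp add: split foldr_lcons_free_reduce reduced_free_reduce)
  show "free_reduce (u @ free_reduce v) = free_reduce (u @ v)"
    by (simp add: split free_reduce_reduced reduced_free_reduce)
qed

lemma reduced_winv: "reduced w \<Longrightarrow> reduced (winv w)"
  unfolding reduced_def winv_def successively_rev successively_map
  by (erule successively_mono) (auto simp: eq_commute)

lemma free_reduce_winv: "free_reduce (winv w @ w) = []"
proof (induction w)
  case (Cons a w)
  have "free_reduce (winv (a # w) @ a # w) = foldr lcons (winv w) (lcons (linv a) (lcons a (free_reduce w)))"
    by (simp add: winv_def free_reduce_def)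
  also have "\<dots> = foldr lcons (winv w) (free_reduce w)"
    by (simp add: lcons_linv reduced_free_reduce)
  also have "\<dots> = free_reduce (winv w @ w)"
    by (simp add: free_reduce_def)
  finally show ?case using Cons by simp
qed (simp add: winv_def free_reduce_def)

lemma winv_in_carrier:
  "w \<in> carrier (free_group X) \<Longrightarrow> winv w \<in> carrier (free_group X)"
  by (auto simp: free_group_def reduced_winv) (auto simp: winv_def linv_def)

lemma group_free_group: "group (free_group X)"
proof (rule groupI)
  fix u v assume "u \<in> carrier (free_group X)" "v \<in> carrier (free_group X)"
  then show "u \<otimes>\<^bsub>free_group X\<^esub> v \<in> carrier (free_group X)"
    using set_free_reduce[of "u @ v"] by (auto simp: free_group_def reduced_free_reduce)
next
  fix u assume u: "u \<in> carrier (free_group X)"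
  then have "winv u \<otimes>\<^bsub>free_group X\<^esub> u = \<one>\<^bsub>free_group X\<^esub>"
    by (simp add: free_group_def free_reduce_winv)
  with winv_in_carrier[OF u]
  show "\<exists>v\<in>carrier (free_group X). v \<otimes>\<^bsub>free_group X\<^esub> u = \<one>\<^bsub>free_group X\<^esub>"
    by blast
qed (auto simp: free_group_def free_reduce_append free_reduce_reduced, simp add: reduced_def)

lemma inv_free_group:
  assumes "w \<in> carrier (free_group X)"
  shows "inv\<^bsub>free_group X\<^esub> w = winv w"
proof (rule group.inv_equality[OF group_free_group])
  show "winv w \<otimes>\<^bsub>free_group X\<^esub> w = \<one>\<^bsub>free_group X\<^esub>"
    by (simp add: free_group_def free_reduce_winv)
qed (use assms winv_in_carrier in auto)

definition freely_conjugate :: "'a set \<Rightarrow> 'a word \<Rightarrow> 'a word \<Rightarrow> bool" where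
  "freely_conjugate X r s \<longleftrightarrow>
     (\<exists>g\<in>carrier (free_group X).
        s = g \<otimes>\<^bsub>free_group X\<^esub> r \<otimes>\<^bsub>free_group X\<^esub> inv\<^bsub>free_group X\<^esub> g)"

definition proper_power :: "'a set \<Rightarrow> 'a word \<Rightarrow> bool" where
  "proper_power X w \<longleftrightarrow>
     (\<exists>v\<in>carrier (free_group X). \<exists>t::nat. t \<ge> 2 \<and> w = v [^]\<^bsub>free_group X\<^esub> t)"


section \<open>Presentations\<close>

text \<open>The relators are elements of the free group on the generators, that is, reduced words.\<close>

record 'a presentation =
  gens :: "'a set"
  rels :: "'a word set"

definition freely_redundant :: "'a presentation \<Rightarrow> 'a word \<Rightarrow> bool" where
  "freely_redundant P r \<longleftrightarrow>
     r = \<one>\<^bsub>free_group (gens P)\<^esub> \<or>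
     (\<exists>s\<in>rels P. r \<noteq> s \<and>
        (freely_conjugate (gens P) r s \<or>
         freely_conjugate (gens P) r (inv\<^bsub>free_group (gens P)\<^esub> s)))"

definition non_redundant :: "'a presentation \<Rightarrow> bool" where
  "non_redundant P \<longleftrightarrow> \<not> (\<exists>r\<in>rels P. freely_redundant P r)"

text \<open>
  The automorphism \<open>x\<^sub>i \<mapsto> x\<^sub>i\<^sub>+\<^sub>1\<close> (subscripts mod \<open>n\<close>) of the free group on \<open>{..<n}\<close>; it permutes
  the letters, so it maps reduced words to reduced words letter by letter.
\<close>

definition shift :: "nat \<Rightarrow> nat word \<Rightarrow> nat word" where
  "shift n w = map (\<lambda>(i, e). ((i + 1) mod n, e)) w"

definition cyclic_presentation :: "nat \<Rightarrow> nat word \<Rightarrow> nat presentation" where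
  "cyclic_presentation n w = \<lparr> gens = {..<n}, rels = {(shift n ^^ i) w | i. i < n} \<rparr>"


section \<open>Undirected multigraphs and girth\<close>

text \<open>\<open>ends G e\<close> is the set of the end points of the edge \<open>e\<close>; it is a singleton if \<open>e\<close> is a loop.\<close>

record ('v, 'e) multigraph =
  verts :: "'v set"
  edges :: "'e set"
  ends :: "'e \<Rightarrow> 'v set"

fun is_path :: "('v, 'e) multigraph \<Rightarrow> 'v \<Rightarrow> 'e list \<Rightarrow> 'v \<Rightarrow> bool" where
  "is_path G u [] v \<longleftrightarrow> u \<in> verts G \<and> u = v"
| "is_path G u (e # es) v \<longleftrightarrow>
     u \<in> verts G \<and> e \<in> edges G \<and> (\<exists>u'. ends G e = {u, u'} \<and> is_path G u' es v)"

definition reduced_closed_path :: "('v, 'e) multigraph \<Rightarrow> 'e list \<Rightarrow> bool" where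
  "reduced_closed_path G es \<longleftrightarrow> (\<exists>v. is_path G v es v) \<and> distinct_adj es"

text \<open>The infimum of the empty set is \<open>\<infinity>\<close>.\<close>

definition girth :: "('v, 'e) multigraph \<Rightarrow> enat" where
  "girth G = (INF es\<in>{es. es \<noteq> [] \<and> reduced_closed_path G es}. enat (length es))"


section \<open>The star graph\<close>

definition symmetrized :: "'a word set \<Rightarrow> 'a word set" where
  "symmetrized R = {rotate k r | k r. r \<in> R \<union> winv ` R}"

text \<open>
  An edge is the inverse pair \<open>{x y\<^sup>-\<^sup>1 u, y x\<^sup>-\<^sup>1 u\<^sup>-\<^sup>1}\<close> of words of the symmetrized set of
  relators; its end points \<open>x\<close> and \<open>y\<close> are the first letters of these two words.
\<close>

definition star_graph :: "'a presentation \<Rightarrow> ('a letter, 'a word set) multigraph" where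
  "star_graph P =
     \<lparr> verts = gens P \<times> UNIV,
       edges = {{x # linv y # u, y # linv x # winv u} | x y u.
                  x # linv y # u \<in> symmetrized (rels P)},
       ends = (\<lambda>e. hd ` e) \<rparr>"

end

theory Submission
  imports Defs "HOL-Number_Theory.Cong"
begin

text \<open>
  The star graph carries a free action of the cyclic group of order \<open>n\<close> by the shift, with quotient
  a graph on two vertices \<open>+\<close> and \<open>-\<close> that has one edge for each cyclic two-letter subword of \<open>w\<close>:
  a loop where the sign of the exponents changes, and otherwise an edge from \<open>+\<close> to \<open>-\<close>. As the
  group is abelian, a closed walk of the quotient that uses each edge equally often in both
  directions lifts to a closed path. Three edges \<open>a\<close>, \<open>b\<close>, \<open>c\<close> from \<open>+\<close> to \<open>-\<close> yield the walk
  \<open>abcabc\<close> of length 6; two loops at the same vertex yield their commutator, of length 4; a loop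
  \<open>a\<close> and edges \<open>c\<close>, \<open>d\<close> from \<open>+\<close> to \<open>-\<close> yield \<open>acdadc\<close>. A word of length at least 3 always gives
  one of these configurations, unless it has length 3 and the quotient consists of a loop \<open>a\<close> at
  \<open>+\<close>, a loop \<open>b\<close> at \<open>-\<close> and an edge \<open>c\<close>; then \<open>acbcacbc\<close> has length 8.

  That the lifts are reduced requires distinct edges of the quotient to have distinct lifts: this
  is where non-redundancy enters, together with the facts that \<open>w\<close> is not a proper power and that
  a nontrivial element of a free group is not conjugate to its inverse.
\<close>

section \<open>Closed paths in abelian covers\<close>

text \<open>
  The vertices of the base graph have type \<open>'b\<close>, its edges are the elements of \<open>J\<close>. The fibre of the
  vertex \<open>b\<close> is the range of \<open>V b\<close>, and \<open>C j\<close> is the fibre of the edge \<open>j\<close>; in \<open>arc j b c d\<close>, \<open>d\<close> is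
  the voltage of \<open>j\<close> when it is traversed from \<open>b\<close> to \<open>c\<close>.
\<close>

locale abelian_cover =
  fixes G :: "('v, 'e) multigraph"
    and V :: "'b \<Rightarrow> 'g::ab_group_add \<Rightarrow> 'v"
    and C :: "'j \<Rightarrow> 'e set"
    and J :: "'j set"
  assumes verts: "V b z \<in> verts G"
    and disjoint: "i \<in> J \<Longrightarrow> j \<in> J \<Longrightarrow> x \<in> C i \<Longrightarrow> x \<in> C j \<Longrightarrow> i = j"
begin

definition arc :: "'j \<Rightarrow> 'b \<Rightarrow> 'b \<Rightarrow> 'g \<Rightarrow> bool" where
  "arc j b c d \<longleftrightarrow>
     j \<in> J \<and> (\<forall>z. \<exists>x\<in>C j. x \<in> edges G \<and> ends G x = {V b z, V c (z + d)})"

text \<open>Directions are left out of the list: reducedness compares consecutive edges only, and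
  lifts of different base edges are different.\<close>

inductive walk :: "'j list \<Rightarrow> 'b \<Rightarrow> 'b \<Rightarrow> 'g \<Rightarrow> bool" where
  Nil: "walk [] b b 0"
| Cons: "arc j b c d \<Longrightarrow> walk js c c' d' \<Longrightarrow> walk (j # js) b c' (d + d')"

lemma arc_reverse:
  assumes "arc j b c d"
  shows "arc j c b (- d)"
proof -
  have "\<exists>x\<in>C j. x \<in> edges G \<and> ends G x = {V c z, V b (z + - d)}" for z
  proof -
    \<comment> \<open>The lift that starts at \<open>V b (z - d)\<close> ends at
      \<open>V c z\<close>; end points are unordered, so it also serves as the reverse arc.\<close>
    obtain x where "x \<in> C j" "x \<in> edges G" "ends G x = {V b (z - d), V c (z - d + d)}"
      using assms unfolding arc_def by blast
    then show ?thesis by (auto simp: insert_commute)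
  qed
  then show ?thesis using assms by (simp add: arc_def)
qed

lemma walk_lift:
  "walk js b c d \<Longrightarrow>
   set js \<subseteq> J \<and> (\<exists>es. is_path G (V b z) es (V c (z + d)) \<and> list_all2 (\<lambda>j x. x \<in> C j) js es)"
proof (induction arbitrary: z rule: walk.induct)
  case (Nil b)
  show ?case by (auto intro!: exI[of _ "[]"] simp: verts)
next
  case (Cons j b c d js c' d')
  obtain es where es: "is_path G (V c (z + d)) es (V c' (z + d + d'))"
    "list_all2 (\<lambda>j x. x \<in> C j) js es" and js: "set js \<subseteq> J"
    using Cons.IH by blast
  obtain x where "x \<in> C j" "x \<in> edges G" "ends G x = {V b z, V c (z + d)}"
    using Cons.hyps(1) unfolding arc_def by blast
  moreover have "j \<in> J"
    using Cons.hyps(1) by (simp add: arc_def)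
  ultimately show ?case
    using es js verts by (auto intro!: exI[of _ "x # es"] simp: add.assoc)
qed

lemma distinct_adj_lift:
  "list_all2 (\<lambda>j x. x \<in> C j) js es \<Longrightarrow> set js \<subseteq> J \<Longrightarrow> distinct_adj js \<Longrightarrow> distinct_adj es"
proof (induction rule: list_all2_induct)
  case (Cons j js x es)
  then show ?case
    by (cases js; cases es) (auto dest: disjoint)
qed simp

text \<open>Voltage zero closes the lift, and disjoint fibres keep it reduced.\<close>

lemma girth_le:
  assumes "walk js b b 0" "js \<noteq> []" "distinct_adj js"
  shows "girth G \<le> length js"
proof -
  obtain es where es: "is_path G (V b 0) es (V b 0)" "list_all2 (\<lambda>j x. x \<in> C j) js es"
    and "set js \<subseteq> J"
    using walk_lift[OF assms(1), of 0] by auto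
  then have "distinct_adj es"
    using distinct_adj_lift assms(3) by blast
  moreover have "length es = length js"
    using es(2) by (simp add: list_all2_lengthD)
  ultimately show ?thesis
    unfolding girth_def using es(1) assms(2)
    by (intro INF_lower2[of es]) (auto simp: reduced_closed_path_def)
qed

lemma walk_singleton: "arc j b c d \<Longrightarrow> walk [j] b c d"
  using walk.Cons[OF _ walk.Nil] by fastforce

section \<open>Closed walks of voltage zero\<close>

lemma girth_le_theta:
  assumes "arc i b c d1" "arc j b c d2" "arc k b c d3" "distinct [i, j, k]"
  shows "girth G \<le> 6"
proof -
  note rev = assms(1-3)[THEN arc_reverse]
  \<comment> \<open>Directions alternate and three is odd, so the second round runs through each
    edge against the first and the voltages cancel.\<close>
  have "walk [i, j, k, i, j, k] b b (d1 + (- d2 + (d3 + (- d1 + (d2 + - d3)))))"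
    using assms rev by (intro walk.Cons walk_singleton)
  then have "walk [i, j, k, i, j, k] b b 0" by simp
  from girth_le[OF this] assms(4) show ?thesis
    by (auto simp: numeral_eq_enat eval_nat_numeral)
qed

lemma girth_le_two_loops:
  assumes "arc i b b d1" "arc j b b d2" "i \<noteq> j"
  shows "girth G \<le> 4"
proof -
  note rev = assms(1-2)[THEN arc_reverse]
  have "walk [i, j, i, j] b b (d1 + (d2 + (- d1 + - d2)))"
    using assms rev by (intro walk.Cons walk_singleton)
  then have "walk [i, j, i, j] b b 0" by simp
  from girth_le[OF this] assms(3) show ?thesis
    by (auto simp: numeral_eq_enat eval_nat_numeral)
qed

text \<open>The commutator of the loop \<open>i\<close> with the closed walk out along
  \<open>j\<close> and back along \<open>k\<close>.\<close>

lemma girth_le_loop_and_digon: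
  assumes "arc i b b d1" "arc j b c d2" "arc k b c d3" "distinct [i, j, k]"
  shows "girth G \<le> 6"
proof -
  note rev = assms(1-3)[THEN arc_reverse]
  have "walk [i, j, k, i, k, j] b b (d1 + (d2 + (- d3 + (- d1 + (d3 + - d2)))))"
    using assms rev by (intro walk.Cons walk_singleton)
  then have "walk [i, j, k, i, k, j] b b 0" by simp
  from girth_le[OF this] assms(4) show ?thesis
    by (auto simp: numeral_eq_enat eval_nat_numeral)
qed

text \<open>The commutator of the loop \<open>i\<close> with the loop \<open>j\<close> conjugated by
  \<open>k\<close>.\<close>

lemma girth_le_dumbbell:
  assumes "arc i b b d1" "arc j c c d2" "arc k b c d3" "distinct [i, j, k]"
  shows "girth G \<le> 8"
proof -
  note rev = assms(1-3)[THEN arc_reverse]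
  have "walk [i, k, j, k, i, k, j, k] b b
    (d1 + (d3 + (d2 + (- d3 + (- d1 + (d3 + (- d2 + - d3)))))))"
    using assms rev by (intro walk.Cons walk_singleton)
  then have "walk [i, k, j, k, i, k, j, k] b b 0" by simp
  from girth_le[OF this] assms(4) show ?thesis
    by (auto simp: numeral_eq_enat eval_nat_numeral)
qed

end


section \<open>Rotations of cyclically reduced words\<close>

lemma winv_winv [simp]: "winv (winv w) = w"
  by (simp add: winv_def rev_map o_def)

lemma length_winv [simp]: "length (winv w) = length w"
  by (simp add: winv_def)

lemma winv_rotate: "\<exists>m. winv (rotate k w) = rotate m (winv w)"
proof -
  have "winv (rotate k w) = rev (rotate k (map linv w))"
    by (simp add: winv_def rotate_map)
  also have "\<dots> = rotate (length w - k mod length w) (rev (map linv w))"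
    by (metis length_map length_rev rev_rev_ident rotate_rev)
  finally show ?thesis by (auto simp: winv_def)
qed

lemma rotate_eq_rotateD:
  assumes "rotate a u = rotate b v"
  shows "\<exists>m. v = rotate m u"
proof (cases "v = []")
  case False
  have "length u = length v"
    by (metis assms length_rotate)
  let ?l = "length v"
  have "b mod ?l < ?l" using False by simp
  have "rotate (?l - b mod ?l) (rotate b v) = rotate (?l - b mod ?l) (rotate (b mod ?l) v)"
    using rotate_conv_mod[of b v] by simp
  also have "\<dots> = v"
    using \<open>b mod ?l < ?l\<close> by (simp add: rotate_rotate rotate_length01)
  finally have "v = rotate (?l - b mod ?l + a) u"
    using assms by (simp add: rotate_rotate[symmetric])
  then show ?thesis ..
qed (use assms in auto)

lemma cyclically_reduced_nth:
  assumes "cyclically_reduced w" "w \<noteq> []"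
  shows "w ! (Suc t mod length w) \<noteq> linv (w ! (t mod length w))"
proof (cases "Suc (t mod length w) = length w")
  case True
  then have "w ! (Suc t mod length w) = hd w"
    using assms(2) by (simp add: mod_Suc hd_conv_nth)
  moreover have "w ! (t mod length w) = last w"
    using True assms(2) by (metis diff_Suc_1 last_conv_nth)
  ultimately show ?thesis
    using assms by (simp add: cyclically_reduced_def)
next
  case False
  then have "Suc (t mod length w) < length w"
    using assms(2) by (metis Suc_lessI length_greater_0_conv mod_less_divisor)
  moreover from this have "Suc t mod length w = Suc (t mod length w)"
    by (simp add: mod_Suc)
  ultimately show ?thesis
    using assms(1) by (auto simp: cyclically_reduced_def reduced_def successively_conv_nth)
qed

lemma reduced_rotate:
  assumes "cyclically_reduced w"
  shows "reduced (rotate k w)"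
  unfolding reduced_def successively_conv_nth
proof (intro allI impI)
  fix i assume "Suc i < length (rotate k w)"
  moreover from this have "w \<noteq> []" by auto
  ultimately show "rotate k w ! Suc i \<noteq> linv (rotate k w ! i)"
    using cyclically_reduced_nth[OF assms, of "k + i"] by (simp add: nth_rotate)
qed

text \<open>For \<open>w = u @ v\<close>, conjugation by the inverse of \<open>u\<close> yields
  \<open>v @ u\<close>, which is reduced because \<open>w\<close> is cyclically reduced.\<close>

lemma freely_conjugate_rotate:
  assumes "w \<in> carrier (free_group X)" "cyclically_reduced w"
  shows "freely_conjugate X w (rotate m w)"
proof -
  define l where "l = m mod length w"
  define u v where "u = take l w" and "v = drop l w"
  have w: "w = u @ v" by (simp add: u_def v_def)
  have rot: "rotate m w = v @ u"
    by (simp add: u_def v_def l_def rotate_drop_take)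
  have u: "u \<in> carrier (free_group X)" and "reduced v"
    using assms(1) by (auto simp: w free_group_def reduced_def successively_append_iff)
  let ?g = "winv u"
  have g: "?g \<in> carrier (free_group X)"
    using u by (rule winv_in_carrier)
  have "free_reduce (?g @ w) = free_reduce (free_reduce (winv u @ u) @ v)"
    by (simp only: free_reduce_append) (simp add: w)
  then have "free_reduce (?g @ w) = v"
    using \<open>reduced v\<close> by (simp add: free_reduce_winv free_reduce_reduced)
  moreover have "free_reduce (v @ u) = v @ u"
    using reduced_rotate[OF assms(2), of m] by (simp add: rot free_reduce_reduced)
  ultimately have "rotate m w = ?g \<otimes>\<^bsub>free_group X\<^esub> w \<otimes>\<^bsub>free_group X\<^esub> inv\<^bsub>free_group X\<^esub> ?g"
    using rot by (simp add: inv_free_group[OF g]) (simp add: free_group_def)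
  with g show ?thesis
    unfolding freely_conjugate_def by blast
qed

lemma rotate_neq_winv:
  fixes w :: "'a word"
  assumes "cyclically_reduced w" "w \<noteq> []"
  shows "rotate m w \<noteq> winv w"
proof
  assume eq: "rotate m w = winv w"
  let ?k = "length w"
  define W where "W t = w ! (t mod ?k)" for t
  have reflect: "W (p + m) = linv (W (?k - 1 - p))" if "p < ?k" for p
    using that arg_cong[OF eq, of "\<lambda>v. v ! p"]
    by (simp add: W_def nth_rotate winv_def rev_nth add.commute)
  have linv_neq: "linv a \<noteq> a" for a :: "'a letter"
    by (simp add: linv_def prod_eq_iff)
  define m' where "m' = m mod ?k"
  have m': "m' < ?k" using assms(2) by (simp add: m'_def)
  have reflect': "W (p + m') = linv (W (?k - 1 - p))" if "p < ?k" for p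
    using reflect[OF that] by (simp add: W_def m'_def mod_simps)
  text \<open>
    The reflection of the cyclic word that exchanges the positions \<open>p + m'\<close> and \<open>k - 1 - p\<close> either
    fixes a position or exchanges two adjacent ones.
  \<close>
  show False
  proof (cases "odd (?k - m')")
    case True
    then obtain p where "?k - m' = 2 * p + 1" by (rule oddE)
    then have "p + m' = ?k - 1 - p" "p < ?k" using m' by auto
    then show False using reflect'[of p] linv_neq by metis
  next
    case False
    then obtain q where q: "?k - m' = 2 * q" using evenE by blast
    \<comment> \<open>\<open>q\<close> is positive because \<open>m' < ?k\<close>, so the truncated
      subtraction is exact.\<close>
    define p where "p = q - 1"
    have p: "p < ?k" "?k - 1 - p = Suc (p + m')"
      using q m' by (auto simp: p_def)
    then have "W (p + m') = linv (W (Suc (p + m')))"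
      using reflect' by metis
    then show False
      using cyclically_reduced_nth[OF assms, of "p + m'"] by (simp add: W_def)
  qed
qed

lemma pow_free_group:
  assumes "v \<in> carrier (free_group X)"
  shows "v [^]\<^bsub>free_group X\<^esub> (t::nat) = free_reduce (concat (replicate t v))"
proof (induction t)
  case 0
  show ?case by (simp add: nat_pow_def) (simp add: free_group_def free_reduce_def)
next
  case (Suc t)
  interpret group "free_group X" by (rule group_free_group)
  have "v [^]\<^bsub>free_group X\<^esub> Suc t = v [^]\<^bsub>free_group X\<^esub> t \<otimes>\<^bsub>free_group X\<^esub> v"
    by simp
  also have "\<dots> = free_reduce (free_reduce (concat (replicate t v)) @ v)"
    by (simp only: Suc) (simp add: free_group_def)
  also have "\<dots> = free_reduce (concat (replicate (Suc t) v))"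
    by (simp only: free_reduce_append replicate_Suc replicate_append_same[symmetric]) simp
  finally show ?case .
qed

text \<open>The two parts of \<open>w\<close> cut at \<open>m\<close> commute, hence are powers of a
  common word; both are nonempty, so the exponents add up to at least 2.\<close>

lemma proper_power_if_rotate_eq:
  assumes "w \<in> carrier (free_group X)" "rotate m w = w" "0 < m" "m < length w"
  shows "proper_power X w"
proof -
  have "take m w @ drop m w = drop m w @ take m w"
    using assms(2,4) by (simp add: rotate_drop_take)
  then obtain a b v where v: "concat (replicate a v) = take m w" "concat (replicate b v) = drop m w"
    using comm_append_are_replicate by blast
  have "a \<noteq> 0" "b \<noteq> 0"
    using v assms(3,4) by (auto intro!: Nat.gr0I)
  have w: "w = concat (replicate (a + b) v)"
    by (simp add: replicate_add v)
  then obtain u where "w = v @ u"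
    using \<open>a \<noteq> 0\<close> by (cases a) auto
  then have "v \<in> carrier (free_group X)"
    using assms(1) by (auto simp: free_group_def reduced_def successively_append_iff)
  moreover from this have "w = v [^]\<^bsub>free_group X\<^esub> (a + b)"
    using assms(1) by (simp add: pow_free_group w[symmetric] free_reduce_reduced)
      (simp add: free_group_def free_reduce_reduced)
  moreover have "a + b \<ge> 2"
    using \<open>a \<noteq> 0\<close> \<open>b \<noteq> 0\<close> by simp
  ultimately show ?thesis
    unfolding proper_power_def by blast
qed

lemma rotate_inj_not_proper_power:
  assumes "w \<in> carrier (free_group X)" "\<not> proper_power X w"
    and "rotate a w = rotate b w" "a < length w" "b < length w"
  shows "a = b"
proof -
  have False if "rotate a w = rotate b w" "a < b" "b < length w" for a b
  proof -
    have "rotate (length w - a) (rotate a w) = w"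
      using that(2,3) by (simp add: rotate_rotate)
    moreover have "(length w - a + b) mod length w = b - a"
      using that by (simp add: le_mod_geq)
    then have "rotate (length w - a) (rotate b w) = rotate (b - a) w"
      by (metis rotate_conv_mod rotate_rotate)
    ultimately have "rotate (b - a) w = w"
      using that(1) by simp
    moreover have "0 < b - a" "b - a < length w"
      using that(2,3) by auto
    ultimately show False
      using proper_power_if_rotate_eq[OF assms(1), of "b - a"] assms(2) by simp
  qed
  then show ?thesis
    using assms(3-5) by (metis linorder_neqE_nat)
qed


section \<open>The star graph of a cyclic presentation\<close>

definition shift_letter :: "nat \<Rightarrow> nat \<Rightarrow> nat letter \<Rightarrow> nat letter" where
  "shift_letter n i a = ((fst a + i) mod n, snd a)"

text \<open>The bound on the letters matters at \<open>i = 0\<close>, where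
  \<open>shift_letter n 0\<close> still reduces subscripts mod \<open>n\<close>.\<close>

lemma shift_funpow:
  "set w \<subseteq> {..<n} \<times> UNIV \<Longrightarrow> (shift n ^^ i) w = map (shift_letter n i) w"
proof (induction i)
  case 0
  then show ?case by (auto simp: shift_letter_def intro!: map_idI[symmetric])
next
  case (Suc i)
  then show ?case by (auto simp: shift_def shift_letter_def mod_simps)
qed

lemma shift_letter_linv: "shift_letter n i (linv a) = linv (shift_letter n i a)"
  by (simp add: shift_letter_def linv_def)

lemma inj_on_shift_letter: "inj_on (shift_letter n i) ({..<n} \<times> UNIV)"
proof (rule inj_onI)
  fix a b assume ab: "a \<in> {..<n} \<times> UNIV" "b \<in> {..<n} \<times> UNIV"
    and eq: "shift_letter n i a = shift_letter n i b"
  then have "[fst a + i = fst b + i] (mod n)"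
    by (simp add: shift_letter_def cong_def)
  then have "[fst a = fst b] (mod n)"
    by (simp add: cong_add_rcancel_nat)
  then show "a = b"
    using ab eq by (auto simp: shift_letter_def cong_def)
qed

lemma cyclically_reduced_shift:
  assumes w: "set w \<subseteq> {..<n} \<times> UNIV" and red: "cyclically_reduced w"
  shows "cyclically_reduced ((shift n ^^ i) w)"
proof -
  have neq: "shift_letter n i b \<noteq> linv (shift_letter n i a)"
    if "a \<in> set w" "b \<in> set w" "b \<noteq> linv a" for a b
  proof -
    have "b \<in> {..<n} \<times> UNIV" "linv a \<in> {..<n} \<times> UNIV"
      using w that by (auto simp: linv_def)
    then show ?thesis
      using inj_on_shift_letter[of n i] that(3) by (auto simp: shift_letter_linv[symmetric] inj_on_def)
  qed
  have "reduced (map (shift_letter n i) w)"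
    using red neq by (auto simp: cyclically_reduced_def reduced_def successively_conv_nth)
  moreover have "hd (map (shift_letter n i) w) \<noteq> linv (last (map (shift_letter n i) w))"
    if "w \<noteq> []"
    using red neq that by (simp add: cyclically_reduced_def hd_map last_map)
  ultimately show ?thesis
    by (simp add: cyclically_reduced_def shift_funpow[OF w])
qed

text \<open>If \<open>r\<close> is x y^-1 u, its inverse ends in y x^-1; the rotation brings these
  two letters to the front, which gives the partner word of the edge.\<close>

definition star_edge :: "'a word \<Rightarrow> 'a word set" where
  "star_edge r = {r, rotate (length r - 2) (winv r)}"

lemma star_edge:
  assumes "r \<in> symmetrized (rels P)" "length r \<ge> 2"
  shows "star_edge r \<in> edges (star_graph P)"
    and "ends (star_graph P) (star_edge r) = {r ! 0, linv (r ! 1)}"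
proof -
  obtain x y' u where "r = x # y' # u"
    using assms(2) by (cases r rule: remdups_adj.cases) auto
  then obtain y where r: "r = x # linv y # u"
    by (metis linv_linv)
  have "winv r = winv u @ [y, linv x]"
    by (simp add: r winv_def)
  then have "rotate (length r - 2) (winv r) = y # linv x # winv u"
    using rotate_append[of "winv u" "[y, linv x]"] by (simp add: r)
  then have e: "star_edge r = {x # linv y # u, y # linv x # winv u}"
    by (simp add: star_edge_def r)
  then show "star_edge r \<in> edges (star_graph P)"
    using assms(1) unfolding r star_graph_def multigraph.simps by blast
  show "ends (star_graph P) (star_edge r) = {r ! 0, linv (r ! 1)}"
    by (simp add: star_graph_def e) (simp add: r)
qed

text \<open>Either the leading words agree, or one is the partner of the other; in the second case
  the offsets are irrelevant later and are absorbed into \<open>m\<close>.\<close>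

lemma star_edge_eqD:
  assumes "star_edge (rotate a r) = star_edge (rotate b s)"
  shows "rotate a r = rotate b s \<or> (\<exists>m. winv s = rotate m r)"
proof -
  have "rotate a r \<in> star_edge (rotate b s)"
    using assms by (auto simp: star_edge_def)
  then consider "rotate a r = rotate b s" | m where "rotate a r = rotate m (winv (rotate b s))"
    by (auto simp: star_edge_def)
  then show ?thesis
  proof cases
    case 2
    then obtain m' where "rotate a r = rotate m' (winv s)"
      by (metis winv_rotate rotate_rotate)
    then show ?thesis by (blast dest: rotate_eq_rotateD)
  qed simp
qed

text \<open>Without a descent \<open>P\<close> persists upwards from \<open>x\<close>, up to
  \<open>y + k * x\<close>, which is congruent to \<open>y\<close>.\<close>

lemma periodic_descent:
  fixes P :: "nat \<Rightarrow> bool"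
  assumes "\<And>t. P (t mod k) = P t" "P x" "\<not> P y" "y < k"
  shows "\<exists>t<k. P t \<and> \<not> P (Suc t)"
proof -
  have "\<exists>t. P t \<and> \<not> P (Suc t)"
  proof (rule ccontr)
    assume "\<not> ?thesis"
    then have "P (x + m)" for m
      by (induction m) (auto simp: assms(2))
    moreover have "x \<le> y + k * x"
      using assms(4) by (cases k) auto
    ultimately have "P (y + k * x)"
      using le_Suc_ex by metis
    then show False
      using assms(1)[of "y + k * x"] assms(3,4) by simp
  qed
  then obtain t where t: "P t" "\<not> P (Suc t)" by blast
  \<comment> \<open>\<open>Suc (t mod k)\<close> may equal \<open>k\<close>, so periodicity enters
    here too.\<close>
  have "P (Suc (t mod k)) = P (Suc t)"
    using assms(1)[of "Suc (t mod k)"] assms(1)[of "Suc t"] by (simp add: mod_Suc_eq)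
  moreover have "t mod k < k"
    using assms(4) by simp
  ultimately show ?thesis
    using t assms(1) by blast
qed

text \<open>Equal edges make the two relators conjugate up to inversion, so non-redundancy forces
  \<open>i = i'\<close>; then \<open>w\<close> not being a proper power forces
  \<open>j = j'\<close>.\<close>

lemma cyclic_presentation_lifts_disjoint:
  assumes w: "w \<in> carrier (free_group {..<n})" "cyclically_reduced w" "w \<noteq> []"
    and pow: "\<not> proper_power {..<n} w"
    and red: "non_redundant (cyclic_presentation n w)"
    and i: "i < n" "i' < n" and j: "j < length w" "j' < length w"
    and eq: "star_edge (rotate j ((shift n ^^ i) w)) = star_edge (rotate j' ((shift n ^^ i') w))"
  shows "j = j'"
proof -
  define r where "r i = (shift n ^^ i) w" for i
  have letters: "set w \<subseteq> {..<n} \<times> UNIV"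
    using w(1) by (simp add: free_group_def)
  have r: "r i = map (shift_letter n i) w" for i
    using shift_funpow[OF letters] by (simp add: r_def)
  have cr: "cyclically_reduced (r i)" for i
    using cyclically_reduced_shift[OF letters w(2)] by (simp add: r_def)
  have carrier: "r i \<in> carrier (free_group {..<n})" for i
  proof -
    have "set (r i) \<subseteq> {..<n} \<times> UNIV"
      using i(1) by (auto simp: r shift_letter_def)
    then show ?thesis
      using cr[of i] by (simp add: free_group_def cyclically_reduced_def)
  qed
  have eqD: "rotate j (r i) = rotate j' (r i') \<or> (\<exists>m. winv (r i') = rotate m (r i))"
    using star_edge_eqD eq by (simp add: r_def)
  have "i = i'"
  proof (rule ccontr)
    assume "i \<noteq> i'"
    \<comment> \<open>Redundancy concerns distinct relators; here the first letters already
      differ.\<close>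
    have "r i \<noteq> r i'"
    proof
      assume "r i = r i'"
      then have "hd (r i) = hd (r i')" by simp
      then have "[fst (hd w) + i = fst (hd w) + i'] (mod n)"
        using w(3) by (simp add: r hd_map shift_letter_def cong_def)
      then have "[i = i'] (mod n)"
        by (simp add: cong_add_lcancel_nat)
      then show False
        using i \<open>i \<noteq> i'\<close> by (simp add: cong_def)
    qed
    moreover have "freely_conjugate {..<n} (r i) (r i') \<or>
        freely_conjugate {..<n} (r i) (inv\<^bsub>free_group {..<n}\<^esub> (r i'))"
      using eqD freely_conjugate_rotate[OF carrier cr] rotate_eq_rotateD
      by (metis carrier inv_free_group)
    moreover have "r i \<in> rels (cyclic_presentation n w)" "r i' \<in> rels (cyclic_presentation n w)"
      using i by (auto simp: cyclic_presentation_def r_def)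
    ultimately have "freely_redundant (cyclic_presentation n w) (r i)"
      by (auto simp: freely_redundant_def cyclic_presentation_def)
    then show False
      using red \<open>r i \<in> rels _\<close> by (auto simp: non_redundant_def)
  qed
  \<comment> \<open>This leaves only equality of the leading words, from which the injective shift
    is cancelled.\<close>
  moreover have "winv (r i) \<noteq> rotate m (r i)" for m
    using rotate_neq_winv[OF cr, of i m] w(3) by (simp add: r)
  ultimately have "map (shift_letter n i) (rotate j w) = map (shift_letter n i) (rotate j' w)"
    using eqD by (auto simp: r rotate_map)
  then have "rotate j w = rotate j' w"
    by (rule map_inj_on) (use inj_on_shift_letter letters in \<open>auto intro: inj_on_subset\<close>)
  then show ?thesis
    using rotate_inj_not_proper_power[OF w(1) pow] j by blast
qed

section \<open>The girth bound\<close>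

theorem corollary4p2:
  fixes n :: nat and w :: "nat word"
  assumes "n \<ge> 1"
    and "w \<in> carrier (free_group {..<n})"
    and "cyclically_reduced w"
    and "0 \<in> fst ` set w"
    and "length w \<ge> 3"
    and "\<not> proper_power {..<n} w"
    and "non_redundant (cyclic_presentation n w)"
  shows "girth (star_graph (cyclic_presentation n w)) \<le> 8 \<and>
    (girth (star_graph (cyclic_presentation n w)) > 6 \<longrightarrow>
       \<not> positive_word w \<and> \<not> negative_word w \<and> length w = 3)"
proof -
  define P where "P = cyclic_presentation n w"
  define G where "G = star_graph P"
  define k where "k = length w"
  \<comment> \<open>Voltages are integers; the reduction mod \<open>n\<close> happens inside
    \<open>V\<close>, which need not be injective.\<close>
  define V :: "bool \<Rightarrow> int \<Rightarrow> nat letter" where "V s z = (nat (z mod int n), s)" for s z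
  define e where "e i j = star_edge (rotate j ((shift n ^^ i) w))" for i j
  define C where "C j = {e i j | i. i < n}" for j
  have letters: "set w \<subseteq> {..<n} \<times> UNIV"
    using assms(2) by (simp add: free_group_def)
  have "w \<noteq> []" "k \<ge> 3"
    using assms(5) by (auto simp: k_def)
  interpret abelian_cover G V C "{..<k}"
  proof
    fix s z
    show "V s z \<in> verts G"
      using assms(1) by (simp add: G_def V_def P_def star_graph_def cyclic_presentation_def nat_less_iff)
  next
    fix j j' x assume "j \<in> {..<k}" "j' \<in> {..<k}" "x \<in> C j" "x \<in> C j'"
    then show "j = j'"
      using cyclic_presentation_lifts_disjoint[OF assms(2,3) \<open>w \<noteq> []\<close> assms(6,7)]
      by (auto simp: C_def e_def k_def)
  qed

  define s where "s t = snd (w ! (t mod k))" for t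
  \<comment> \<open>The second letter of the subword is the inverse of an end point, hence the
    negated sign. The voltage is the difference of the subscripts.\<close>
  have arc: "\<exists>d. arc j (s j) (\<not> s (Suc j)) d" if "j < k" for j
  proof -
    define a b where "a = w ! j" and "b = w ! (Suc j mod k)"
    have "a \<in> set w" "b \<in> set w"
      using that \<open>w \<noteq> []\<close> by (auto simp: a_def b_def k_def)
    then have ab: "fst a < n" "fst b < n"
      using letters by auto
    have "\<exists>x\<in>C j. x \<in> edges G \<and>
        ends G x = {V (snd a) z, V (\<not> snd b) (z + (int (fst b) - int (fst a)))}" for z
    proof -
      \<comment> \<open>The shift that carries the letter \<open>a\<close> to the subscript
        \<open>z\<close> mod \<open>n\<close>.\<close>
      define i where "i = nat ((z - int (fst a)) mod int n)"
      have i: "i < n" "int i = (z - int (fst a)) mod int n"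
        using assms(1) by (auto simp: i_def nat_less_iff)
      have V: "shift_letter n i c = V (snd c) (z + (int (fst c) - int (fst a)))" for c
      proof -
        have "int ((fst c + i) mod n) = (z + (int (fst c) - int (fst a))) mod int n"
          by (simp add: zmod_int i(2) mod_simps algebra_simps)
        then show ?thesis
          by (metis V_def nat_int shift_letter_def)
      qed
      define r where "r = rotate j ((shift n ^^ i) w)"
      have r: "r = rotate j (map (shift_letter n i) w)"
        by (simp add: r_def shift_funpow[OF letters])
      have "r \<in> symmetrized (rels P)"
        using i(1) by (auto simp: r_def P_def symmetrized_def cyclic_presentation_def)
      moreover have "length r \<ge> 2"
        using assms(5) by (simp add: r)
      ultimately have "e i j \<in> edges G" "ends G (e i j) = {r ! 0, linv (r ! 1)}"
        using star_edge[of r P] by (simp_all add: e_def G_def r_def)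
      moreover have "r ! 0 = shift_letter n i a" "r ! 1 = shift_letter n i b"
        using that \<open>w \<noteq> []\<close> assms(5) by (auto simp: r nth_rotate a_def b_def k_def)
      ultimately have "ends G (e i j) =
          {V (snd a) z, V (\<not> snd b) (z + (int (fst b) - int (fst a)))}"
        by (simp add: V linv_def) (simp add: V_def)
      then show ?thesis
        using i(1) \<open>e i j \<in> edges G\<close> by (auto simp: C_def)
    qed
    then show ?thesis
      using that by (auto simp: arc_def s_def a_def b_def)
  qed
  have edge: "\<exists>d. arc j True False d" if "j < k" "s j = s (Suc j)" for j
    using arc[OF that(1)] arc_reverse that(2) by (cases "s j") (auto, blast)
  have loop: "\<exists>d. arc j (s j) (s j) d" if "j < k" "s j \<noteq> s (Suc j)" for j
    using arc[OF that(1)] that(2) by (cases "s j") auto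

  have s_mod: "s (t mod k) = s t" for t
    by (simp add: s_def)
  have six: ?thesis if "girth G \<le> 6"
  proof -
    have "girth G \<le> 8"
      using that by (rule order_trans) simp
    then show ?thesis
      using that by (simp add: G_def P_def leD)
  qed
  show ?thesis
  proof (cases "positive_word w \<or> negative_word w")
    case True
    have "s t = s 0" for t
    proof -
      have "w ! (t mod k) \<in> set w" "w ! 0 \<in> set w"
        using \<open>w \<noteq> []\<close> by (auto simp: k_def)
      with True show ?thesis
        by (auto simp: positive_word_def negative_word_def s_def)
    qed
    then have "\<exists>d. arc t True False d" if "t < k" for t
      using edge[OF that] by metis
    moreover have "0 < k" "1 < k" "2 < k"
      using \<open>k \<ge> 3\<close> by simp_all
    ultimately obtain d0 d1 d2
      where "arc 0 True False d0" "arc 1 True False d1" "arc 2 True False d2"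
      by meson
    from girth_le_theta[OF this] show ?thesis
      by (intro six) simp
  next
    case False
    then obtain x y where xy: "x < k" "s x" "y < k" "\<not> s y"
      by (auto simp: positive_word_def negative_word_def in_set_conv_nth k_def s_def)
    obtain a where a: "a < k" "s a" "\<not> s (Suc a)"
      using periodic_descent[of s k x y] xy s_mod by auto
    obtain b where b: "b < k" "\<not> s b" "s (Suc b)"
      using periodic_descent[of "\<lambda>t. \<not> s t" k y x] xy s_mod by auto
    obtain da where da: "arc a True True da"
      using loop[of a] a by auto
    obtain db where db: "arc b False False db"
      using loop[of b] b by auto
    \<comment> \<open>Both vertices already carry a loop, so any further loop is a second one at its
      vertex.\<close>
    have third: "girth G \<le> 4 \<or> (\<exists>d. arc c True False d)"
      if c: "c < k" "c \<noteq> a" "c \<noteq> b" for c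
    proof (cases "s c = s (Suc c)")
      case False
      then obtain d where "arc c (s c) (s c) d"
        using loop[OF c(1)] by blast
      then have "girth G \<le> 4"
        using girth_le_two_loops[OF da, of c] girth_le_two_loops[OF db, of c] c
        by (cases "s c") auto
      then show ?thesis ..
    qed (use edge c in blast)
    have "a \<noteq> b" using a b by auto
    have card: "card ({..<k} - {a, b}) = k - 2"
      using a b \<open>a \<noteq> b\<close> by (simp add: card_Diff_subset)
    \<comment> \<open>Besides \<open>a\<close> and \<open>b\<close>, length 3 leaves one position
      and hence a dumbbell; greater length leaves two.\<close>
    show ?thesis
    proof (cases "k = 3")
      case True
      then have "card ({..<k} - {a, b}) \<noteq> 0"
        using card by simp
      then have "{..<k} - {a, b} \<noteq> {}"
        by (metis card.empty)
      then obtain c where c: "c < k" "c \<noteq> a" "c \<noteq> b" by auto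
      have "girth G \<le> 8"
        using third[OF c]
      proof
        assume "girth G \<le> 4"
        then show ?thesis by (rule order_trans) simp
      next
        assume "\<exists>d. arc c True False d"
        then show ?thesis
          using girth_le_dumbbell[OF da db] c \<open>a \<noteq> b\<close> by auto
      qed
      then show ?thesis
        using \<open>\<not> (positive_word w \<or> negative_word w)\<close> True by (simp add: G_def P_def k_def)
    next
      case False
      then have "2 \<le> card ({..<k} - {a, b})"
        using card \<open>k \<ge> 3\<close> by simp
      then obtain S where "S \<subseteq> {..<k} - {a, b}" "card S = 2"
        by (meson obtain_subset_with_card_n)
      then obtain c d where cd: "c < k" "c \<noteq> a" "c \<noteq> b" "d < k" "d \<noteq> a" "d \<noteq> b" "c \<noteq> d"
        by (auto simp: card_2_iff)
      consider "girth G \<le> 4" | d1 d2 where "arc c True False d1" "arc d True False d2"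
        using third[of c] third[of d] cd by blast
      then have "girth G \<le> 6"
      proof cases
        case 1
        then show ?thesis by (rule order_trans) simp
      next
        case 2
        from girth_le_loop_and_digon[OF da this] cd show ?thesis by simp
      qed
      then show ?thesis by (rule six)
    qed
  qed
qed

end
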